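(* Let $h:J\subseteq\mathbb{R}\to\mathbb{R}$ be a nonnegative super-additive function with $h(t)\ge t$ for all $t\in(0,1)$. Let $f:I\subseteq\mathbb{R}\to\mathbb{R}$ be a differentiable mapping on $I^{\circ}$ such that $f'\in L[a,b]$, where $a,b\in I$ with $a<b$. Let $p,q>1$ with $\frac1p+\frac1q=1$. If $|f'|^q$ is an $h$-concave function on $[a,b]$, then for each $x\in[a,b]$ $$\left|f(x)-\frac{1}{b-a}\int_a^b f(u)\,du\right|\le \frac{1}{\sqrt[q]{2}\,(p+1)^{\frac1p}\,h^{\frac1q}\left(\frac12\right)}\left[\frac{(x-a)^2}{b-a}\left|f'\left(\frac{x+a}{2}\right)\right|+\frac{(b-x)^2}{b-a}\left|f'\left(\frac{x+b}{2}\right)\right|\right].$$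
   Context: $I\subseteq\mathbb{R}$ is an interval, $I^{\circ}$ is its interior, and $L[a,b]$ is the space of Lebesgue integrable functions on $[a,b]$. $J\subseteq\mathbb{R}$ is an interval with $[0,1]\subseteq J$, and $h\not\equiv 0$. $h^{1/q}(1/2)$ means $(h(1/2))^{1/q}$. $h:J\to\mathbb{R}$ is super-additive if $h(x+y)\ge h(x)+h(y)$ for all $x,y\in J$ with $x+y\in J$. A function $g$ on an interval $K$ is $h$-concave on $K$ (for a nonnegative $h:J\to\mathbb{R}$, $h\not\equiv0$) if $g$ is nonnegative and $g(tx+(1-t)y)\ge h(t)g(x)+h(1-t)g(y)$ for all $x,y\in K$ and $t\in[0,1]$. Hypotheses on the values of $f'$ at points of $[a,b]$ presuppose that $f$ is differentiable there (one-sidedly at an endpoint of $I$). *)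

theory Defs
  imports "HOL-Analysis.Analysis"
begin

text \<open>
  Real functions with a domain are total functions paired with a set; both notions below
  only look at values of \<open>h\<close> on \<open>J\<close> (with \<open>{0..1} \<subseteq> J\<close>) and of \<open>g\<close> on \<open>K\<close>. The convention that
  \<open>h\<close> is nonnegative and not identically zero on \<open>J\<close> is not part of \<open>h_concave_on\<close>; it has to
  be assumed alongside.
\<close>

definition super_additive_on :: "real set \<Rightarrow> (real \<Rightarrow> real) \<Rightarrow> bool" where
  "super_additive_on J h \<longleftrightarrow>
     (\<forall>x\<in>J. \<forall>y\<in>J. x + y \<in> J \<longrightarrow> h (x + y) \<ge> h x + h y)"

definition h_concave_on :: "(real \<Rightarrow> real) \<Rightarrow> real set \<Rightarrow> (real \<Rightarrow> real) \<Rightarrow> bool" where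
  "h_concave_on h K g \<longleftrightarrow>
     (\<forall>x\<in>K. g x \<ge> 0) \<and>
     (\<forall>x\<in>K. \<forall>y\<in>K. \<forall>t\<in>{0..1}.
        g (t * x + (1 - t) * y) \<ge> h t * g x + h (1 - t) * g y)"

end

theory Submission
  imports Defs
begin

text \<open>
  Integration by parts (Montgomery's identity) gives
  \<open>(b - a) f(x) - \<integral>f = \<integral>\<^sub>a\<^sup>x (u - a) f'(u) du + \<integral>\<^sub>x\<^sup>b (u - b) f'(u) du\<close>, and each integral is
  estimated as in Hoelder's inequality. Writing \<open>u' = l + r - u\<close> for the reflection of \<open>[l, r]\<close>,
  \<open>h\<close>-concavity at \<open>t = 1/2\<close> bounds \<open>\<bar>f' u\<bar>\<^sup>q + \<bar>f' u'\<bar>\<^sup>q\<close> by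
  \<open>\<bar>f' ((l + r) / 2)\<bar>\<^sup>q / h (1/2)\<close> pointwise. Applying Young's inequality after symmetrising the
  integrand under \<open>u \<mapsto> u'\<close> therefore yields the Hoelder bound without needing
  integrability of \<open>\<bar>f'\<bar>\<^sup>q\<close>.
\<close>

lemma has_integral_reflect_Icc:
  fixes f :: "real \<Rightarrow> real"
  assumes "(f has_integral X) {l..r}"
  shows "((\<lambda>u. f (l + r - u)) has_integral X) {l..r}"
proof -
  have "((\<lambda>u. f (-u)) has_integral X) {-r..-l}"
    using assms by simp
  from has_integral_shift_real_ivl[OF this, of "-(l + r)"] show ?thesis
    by (simp add: algebra_simps)
qed

lemma has_integral_symmetric_powr:
  fixes l r p :: real
  assumes "l \<le> r" "p > 0"
  shows "((\<lambda>u. (u - l) powr p + (r - u) powr p) has_integral 2 * (r - l) powr (p + 1) / (p + 1)) {l..r}"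
proof -
  define F where "F u = ((u - l) powr (p + 1) - (r - u) powr (p + 1)) / (p + 1)" for u
  have "((\<lambda>u. (u - l) powr p + (r - u) powr p) has_integral F r - F l) {l..r}"
  \<comment> \<open>Only in the open interval are both bases positive, so that the powers can be
    differentiated there; at the endpoints continuity of \<open>F\<close> is enough.\<close>
  proof (rule fundamental_theorem_of_calculus_interior[OF assms(1)])
    show "continuous_on {l..r} F"
      unfolding F_def using assms by (intro continuous_intros continuous_on_powr') auto
    fix u assume u: "u \<in> {l<..<r}"
    have "((\<lambda>u. (u - l) powr (p + 1) - (r - u) powr (p + 1)) has_real_derivative
        (p + 1) * ((u - l) powr p + (r - u) powr p)) (at u)"
      using u assms by (auto intro!: derivative_eq_intros simp: algebra_simps)
    from DERIV_cdivide[OF this, of "p + 1"] show "(F has_vector_derivative (u - l) powr p + (r - u) powr p) (at u)"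
      using assms by (simp add: F_def[abs_def] has_real_derivative_iff_has_vector_derivative)
  qed
  moreover have "F r - F l = 2 * (r - l) powr (p + 1) / (p + 1)"
    using assms by (simp add: F_def flip: diff_divide_distrib)
  ultimately show ?thesis by simp
qed

text \<open>The bound is the product of the Hoelder factors:
  \<open>((r - l) powr (p + 1) / (p + 1)) powr (1 / p)\<close> for the weight, and
  \<open>M * (r - l) powr (1 / q)\<close> for \<open>g\<close>, whose symmetrised q-th power mean is
  at most \<open>M\<close>. The exponents of \<open>r - l\<close> add up to 2.\<close>

lemma abs_weighted_integral_le:
  fixes g :: "real \<Rightarrow> real" and l r e p q M X :: real
  assumes lr: "l \<le> r" and e: "e \<in> {l, r}"
    and pq: "p > 1" "q > 1" "1 / p + 1 / q = 1"
    and M: "M \<ge> 0"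
    and sym: "\<And>u. u \<in> {l..r} \<Longrightarrow> \<bar>g u\<bar> powr q + \<bar>g (l + r - u)\<bar> powr q \<le> 2 * M powr q"
    and X: "((\<lambda>u. (u - e) * g u) has_integral X) {l..r}"
  shows "\<bar>X\<bar> \<le> (r - l)\<^sup>2 * (M / (p + 1) powr (1 / p))"
proof -
  \<comment> \<open>The normalisation before Young's inequality divides by \<open>M\<close> and by a
    multiple of \<open>r - l\<close>, so the degenerate cases are settled separately.\<close>
  consider "l = r" | "M = 0" | "l < r" "M > 0"
    using lr M by linarith
  then show ?thesis
  proof cases
    case 1
    then show ?thesis using X by (simp add: has_integral_refl has_integral_unique)
  next
    case 2
    have "g u = 0" if "u \<in> {l..r}" for u
    proof -
      have "2 * M powr q = 0"
        using 2 by simp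
      then have "\<bar>g u\<bar> powr q \<le> 0"
        using sym[OF that] powr_ge_zero[of "\<bar>g (l + r - u)\<bar>" q] by linarith
      then show ?thesis by simp
    qed
    then have "((\<lambda>u. (u - e) * g u) has_integral 0) {l..r}"
      by (intro has_integral_is_0) auto
    from has_integral_unique[OF X this] show ?thesis
      using 2 by simp
  next
    case 3
    define D where "D = r - l"
    \<comment> \<open>\<open>A\<close> is the p-th power mean of \<open>\<bar>u - e\<bar>\<close>
      over the interval. Scaling the two factors by \<open>A\<close> and \<open>M\<close> makes the
      Young terms average to at most \<open>1 / p + 1 / q = 1\<close>, so no constant is lost. The
      factor \<open>C\<close> below is \<open>1 / (p * A powr p)\<close>.\<close>
    define A where "A = D / (p + 1) powr (1 / p)"
    define C where "C = (p + 1) / (D powr p * p)"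
    define K where "K u = (u - e) * g u" for u
    have D: "D > 0" and A: "A > 0"
      using 3 pq by (auto simp: D_def A_def)
    have A_powr: "A powr p = D powr p / (p + 1)"
      using D pq by (simp add: A_def powr_divide powr_powr)
    have young: "\<bar>K u\<bar> \<le> A * M * (\<bar>u - e\<bar> powr p * C + \<bar>g u\<bar> powr q / (M powr q * q))" for u
    proof -
      have "(\<bar>u - e\<bar> / A) * (\<bar>g u\<bar> / M)
          \<le> (\<bar>u - e\<bar> / A) powr p / p + (\<bar>g u\<bar> / M) powr q / q"
        using A 3 pq by (intro Youngs_inequality) auto
      also have "\<dots> = \<bar>u - e\<bar> powr p * C + \<bar>g u\<bar> powr q / (M powr q * q)"
        using A D 3 pq by (simp add: powr_divide A_powr C_def)
      finally have "\<bar>u - e\<bar> * \<bar>g u\<bar>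
          \<le> A * M * (\<bar>u - e\<bar> powr p * C + \<bar>g u\<bar> powr q / (M powr q * q))"
        using A 3 by (simp add: field_simps)
      then show ?thesis
        by (simp add: K_def abs_mult)
    qed
    \<comment> \<open>The sum of the Young bounds at \<open>u\<close> and at its reflection, with
      the terms in \<open>g\<close> replaced by their bound from \<open>sym\<close>. It no longer
      contains \<open>g\<close>, so it has an explicit integral.\<close>
    define B where "B u = A * M * (((u - l) powr p + (r - u) powr p) * C + 2 / q)" for u
    have bound: "norm (K u + K (l + r - u)) \<le> B u" if u: "u \<in> {l..r}" for u
    proof -
      \<comment> \<open>Reflection swaps the distances to the two endpoints, so both choices of
        \<open>e\<close> give the same sum.\<close>
      have weights: "\<bar>u - e\<bar> powr p + \<bar>l + r - u - e\<bar> powr p = (u - l) powr p + (r - u) powr p"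
        using e u by auto
      have "(\<bar>g u\<bar> powr q + \<bar>g (l + r - u)\<bar> powr q) / (M powr q * q)
          \<le> 2 * M powr q / (M powr q * q)"
        using sym[OF u] pq 3 by (intro divide_right_mono) auto
      then have g: "\<bar>g u\<bar> powr q / (M powr q * q) + \<bar>g (l + r - u)\<bar> powr q / (M powr q * q) \<le> 2 / q"
        using 3 by (simp add: add_divide_distrib)
      have "norm (K u + K (l + r - u)) \<le> \<bar>K u\<bar> + \<bar>K (l + r - u)\<bar>"
        by simp
      also have "\<dots> \<le> A * M * ((\<bar>u - e\<bar> powr p + \<bar>l + r - u - e\<bar> powr p) * C
          + (\<bar>g u\<bar> powr q / (M powr q * q) + \<bar>g (l + r - u)\<bar> powr q / (M powr q * q)))"
        using add_mono[OF young[of u] young[of "l + r - u"]] by (simp add: algebra_simps)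
      also have "\<dots> \<le> B u"
        unfolding weights B_def using g A M by (intro mult_left_mono add_left_mono) auto
      finally show ?thesis .
    qed
    have "((\<lambda>u. A * M * (((u - l) powr p + (r - u) powr p) * C + 2 / q)) has_integral
        A * M * (2 * (r - l) powr (p + 1) / (p + 1) * C + (r - l) *\<^sub>R (2 / q))) {l..r}"
      using lr pq has_integral_const_real[of "2 / q" l r]
      by (intro has_integral_mult_right has_integral_add has_integral_mult_left
            has_integral_symmetric_powr) auto
    moreover have "2 * (r - l) powr (p + 1) / (p + 1) * C = 2 * D / p"
      using D pq by (simp add: C_def powr_add flip: D_def)
    ultimately have "(B has_integral A * M * (2 * D / p + D * (2 / q))) {l..r}"
      by (simp add: B_def[abs_def] flip: D_def)
    moreover have "2 * D / p + D * (2 / q) = 2 * D * (1 / p + 1 / q)"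
      by (simp add: distrib_left)
    ultimately have B: "(B has_integral 2 * (A * M * D)) {l..r}"
      by (simp add: pq(3) mult_ac)
    have K: "((\<lambda>u. K u + K (l + r - u)) has_integral X + X) {l..r}"
      using X by (intro has_integral_add has_integral_reflect_Icc) (auto simp: K_def[abs_def])
    have "norm (integral {l..r} (\<lambda>u. K u + K (l + r - u))) \<le> integral {l..r} B"
      using K B bound by (intro integral_norm_bound_integral) (auto simp: integrable_on_def)
    then have "\<bar>X + X\<bar> \<le> 2 * (A * M * D)"
      unfolding integral_unique[OF K] integral_unique[OF B] by simp
    moreover have "A * M * D = (r - l)\<^sup>2 * (M / (p + 1) powr (1 / p))"
      by (simp add: A_def D_def power2_eq_square)
    ultimately show ?thesis by simp
  qed
qed

text \<open>Product rule: \<open>(u - e) * f u\<close> has derivative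
  \<open>f u + (u - e) * f' u\<close>, and the integral of the continuous \<open>f\<close> is
  subtracted. The free \<open>e\<close> allows one boundary term to be cancelled.\<close>

lemma has_integral_weighted_derivative:
  fixes f f' :: "real \<Rightarrow> real"
  assumes "l \<le> r"
    and deriv: "\<And>u. u \<in> {l..r} \<Longrightarrow> (f has_real_derivative f' u) (at u within {l..r})"
  shows "((\<lambda>u. (u - e) * f' u) has_integral (r - e) * f r - (l - e) * f l - integral {l..r} f) {l..r}"
proof -
  have "(f has_integral integral {l..r} f) {l..r}"
    using deriv by (intro integrable_integral integrable_continuous_real DERIV_continuous_on)
  moreover have "((\<lambda>u. f u + (u - e) * f' u) has_integral (r - e) * f r - (l - e) * f l) {l..r}"
    using assms(1)
    by (rule fundamental_theorem_of_calculus)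
      (auto intro!: derivative_eq_intros deriv
        simp flip: has_real_derivative_iff_has_vector_derivative)
  ultimately show ?thesis
    by (auto dest: has_integral_diff)
qed

text \<open>A point and its reflection always have midpoint \<open>(l + r) / 2\<close>, and at
  \<open>t = 1 / 2\<close> both weights equal \<open>h (1 / 2)\<close>.\<close>

lemma h_concave_on_reflect_le:
  assumes conc: "h_concave_on h K g" and K: "is_interval K" "l \<in> K" "r \<in> K"
    and u: "u \<in> {l..r}"
  shows "h (1 / 2) * (g u + g (l + r - u)) \<le> g ((l + r) / 2)"
proof -
  have "u \<in> K" "l + r - u \<in> K"
    using u by (auto intro: mem_is_interval_1_I[OF K])
  moreover have "(1 / 2 :: real) \<in> {0..1}"
    by simp
  ultimately have "g (1 / 2 * u + (1 - 1 / 2) * (l + r - u)) \<ge> h (1 / 2) * g u + h (1 - 1 / 2) * g (l + r - u)"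
    using conc unfolding h_concave_on_def by blast
  also have "1 / 2 * u + (1 - 1 / 2) * (l + r - u) = (l + r) / 2"
    by (simp add: field_simps)
  finally show ?thesis by (simp add: algebra_simps)
qed

theorem theorem5:
  fixes h f f' :: "real \<Rightarrow> real" and I J :: "real set" and a b p q x :: real
  assumes J: "is_interval J" "{0..1} \<subseteq> J"
    and h_nonneg: "\<And>t. t \<in> J \<Longrightarrow> h t \<ge> 0"
    and h_nonzero: "\<exists>t\<in>J. h t \<noteq> 0"
    and h_super: "super_additive_on J h"
    and h_ge: "\<And>t. t \<in> {0<..<1} \<Longrightarrow> h t \<ge> t"
    and I: "is_interval I"
    and ab: "a \<in> I" "b \<in> I" "a < b"
    and deriv_interior: "\<And>u. u \<in> interior I \<Longrightarrow> (f has_real_derivative f' u) (at u)"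
    and deriv_ab: "\<And>u. u \<in> {a..b} \<Longrightarrow> (f has_real_derivative f' u) (at u within I)"
    and f'_int: "f' absolutely_integrable_on {a..b}"
    and pq: "p > 1" "q > 1" "1 / p + 1 / q = 1"
    and conc: "h_concave_on h {a..b} (\<lambda>u. \<bar>f' u\<bar> powr q)"
    and x: "x \<in> {a..b}"
  shows "\<bar>f x - 1 / (b - a) * integral {a..b} f\<bar>
    \<le> 1 / (2 powr (1 / q) * (p + 1) powr (1 / p) * h (1 / 2) powr (1 / q)) *
       ((x - a)\<^sup>2 / (b - a) * \<bar>f' ((x + a) / 2)\<bar> + (b - x)\<^sup>2 / (b - a) * \<bar>f' ((x + b) / 2)\<bar>)"
proof -
  have h_half: "h (1 / 2) > 0"
    using h_ge[of "1 / 2"] by simp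
  define W where "W = 2 powr (1 / q) * (p + 1) powr (1 / p) * h (1 / 2) powr (1 / q)"
  have subI: "{a..b} \<subseteq> I"
    using mem_is_interval_1_I[OF I ab(1,2)] by auto
  define R where "R l r e = (r - e) * f r - (l - e) * f l - integral {l..r} f" for l r e
  have piece: "\<bar>R l r e\<bar> \<le> (r - l)\<^sup>2 * (\<bar>f' ((l + r) / 2)\<bar> / W)"
    if lr: "a \<le> l" "l \<le> r" "r \<le> b" and e: "e \<in> {l, r}" for l r e
  proof -
    \<comment> \<open>Chosen so that \<open>2 * M powr q\<close> is exactly
      \<open>\<bar>f' ((l + r) / 2)\<bar> powr q / h (1 / 2)\<close>, the bound that
      \<open>h\<close>-concavity provides.\<close>
    define M where "M = \<bar>f' ((l + r) / 2)\<bar> / (2 powr (1 / q) * h (1 / 2) powr (1 / q))"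
    have M_powr: "M powr q = \<bar>f' ((l + r) / 2)\<bar> powr q / (2 * h (1 / 2))"
      using h_half pq by (simp add: M_def powr_divide powr_mult powr_powr)
    have sym: "\<bar>f' u\<bar> powr q + \<bar>f' (l + r - u)\<bar> powr q \<le> 2 * M powr q" if "u \<in> {l..r}" for u
      using h_concave_on_reflect_le[OF conc _ _ _ that] lr h_half
      by (simp add: M_powr field_simps is_interval_cc)
    have "((\<lambda>u. (u - e) * f' u) has_integral R l r e) {l..r}"
      unfolding R_def using lr subI
      by (intro has_integral_weighted_derivative DERIV_subset[OF deriv_ab]) auto
    from abs_weighted_integral_le[OF lr(2) e pq _ sym this]
    have "\<bar>R l r e\<bar> \<le> (r - l)\<^sup>2 * (M / (p + 1) powr (1 / p))"
      by (simp add: M_def)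
    then show ?thesis
      by (simp add: M_def W_def mult_ac)
  qed
  have "f integrable_on {a..b}"
    using subI deriv_ab
    by (intro integrable_continuous_real DERIV_continuous_on) (blast intro: DERIV_subset)
  then have split: "integral {a..x} f + integral {x..b} f = integral {a..b} f"
    using x by (intro Henstock_Kurzweil_Integration.integral_combine) auto
  \<comment> \<open>With \<open>e = a\<close> on the left piece and \<open>e = b\<close> on the
    right one, the boundary terms at \<open>a\<close> and \<open>b\<close> vanish, and those at
    \<open>x\<close> add up to \<open>(b - a) * f x\<close>.\<close>
  have "f x - 1 / (b - a) * integral {a..b} f = (R a x a + R x b b) / (b - a)"
    using ab by (simp add: R_def field_simps flip: split)
  then have "\<bar>f x - 1 / (b - a) * integral {a..b} f\<bar> = \<bar>R a x a + R x b b\<bar> / (b - a)"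
    using ab by simp
  also have "\<dots> \<le> ((x - a)\<^sup>2 * (\<bar>f' ((a + x) / 2)\<bar> / W) + (b - x)\<^sup>2 * (\<bar>f' ((x + b) / 2)\<bar> / W)) / (b - a)"
    using piece[of a x a] piece[of x b b] x ab by (intro divide_right_mono) auto
  also have "\<dots> = 1 / W * ((x - a)\<^sup>2 / (b - a) * \<bar>f' ((x + a) / 2)\<bar>
      + (b - x)\<^sup>2 / (b - a) * \<bar>f' ((x + b) / 2)\<bar>)"
    by (simp add: add_divide_distrib distrib_left mult_ac add.commute[of a x])
  finally show ?thesis
    unfolding W_def .
qed

end
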